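(* For every positive integer $n$, $$RT(n,K_3,2\text{-mean}) = RT(n,K_3,2) = t(n,R(K_3,2)-1) = t(n,5) = \lfloor 0.4\,n^2 \rfloor .$$
   Context: All graphs are finite, undirected and simple. An edge coloring is an arbitrary assignment of colors to the edges (not necessarily proper, with no a priori bound on the total number of colors unless stated). A color is incident with a vertex $v$ if some edge containing $v$ has that color; an isolated vertex is incident with $0$ colors. For a real $\rho\ge 1$, an edge coloring of a graph with $n$ vertices is called $\rho$-mean if the average, over all $n$ vertices, of the number of distinct colors incident with the vertex is at most $\rho$. A monochromatic copy of $H$ is a (not necessarily induced) subgraph isomorphic to $H$ all of whose edges have the same color. $RT(n,H,\rho\text{-mean})$ is the maximum number of edges of a graph with $n$ vertices that admits a $\rho$-mean edge coloring with no monochromatic copy of $H$. $RT(n,H,k)$ is the maximum number of edges of a graph with $n$ vertices that admits an edge coloring using at most $k$ colors with no monochromatic copy of $H$. $R(H,k)$ is the minimum integer $N$ such that every edge coloring of the complete graph $K_N$ with $k$ colors contains a monochromatic copy of $H$. The Turán graph $T(n,k)$ is the complete $k$-partite graph with $n$ vertices whose vertex classes are as equal in size as possible, and $t(n,k)$ is its number of edges. *)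

theory Defs
  imports Complex_Main "HOL-Library.Ramsey"
begin

text \<open>
  A graph is a pair of a vertex set and an edge set; the edges are 2-element sets of vertices,
  where \<open>[V]\<^bsup>2\<^esup>\<close> is the library notation for the set of 2-element subsets of \<open>V\<close>.
\<close>

type_synonym 'a ugraph = "'a set \<times> 'a set set"

definition simple_graph :: "'a ugraph \<Rightarrow> bool" where
  "simple_graph G \<longleftrightarrow> finite (fst G) \<and> snd G \<subseteq> [fst G]\<^bsup>2\<^esup>"

definition complete_graph :: "nat \<Rightarrow> nat ugraph" where
  "complete_graph n = ({..<n}, [{..<n}]\<^bsup>2\<^esup>)"

text \<open>
  An edge coloring of \<open>G\<close> is a function on sets of vertices, of which only the values on the
  edges of \<open>G\<close> matter. Graphs are finite, so natural numbers provide enough colors and (below)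
  enough vertices.
\<close>

definition incident_colors :: "'a ugraph \<Rightarrow> ('a set \<Rightarrow> nat) \<Rightarrow> 'a \<Rightarrow> nat set" where
  "incident_colors G c v = c ` {e \<in> snd G. v \<in> e}"

definition mean_coloring :: "real \<Rightarrow> 'a ugraph \<Rightarrow> ('a set \<Rightarrow> nat) \<Rightarrow> bool" where
  "mean_coloring \<rho> G c \<longleftrightarrow>
     (\<Sum>v\<in>fst G. real (card (incident_colors G c v))) / real (card (fst G)) \<le> \<rho>"

definition at_most_colors :: "nat \<Rightarrow> 'a ugraph \<Rightarrow> ('a set \<Rightarrow> nat) \<Rightarrow> bool" where
  "at_most_colors k G c \<longleftrightarrow> card (c ` snd G) \<le> k"

definition has_mono_copy :: "'b ugraph \<Rightarrow> 'a ugraph \<Rightarrow> ('a set \<Rightarrow> nat) \<Rightarrow> bool" where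
  "has_mono_copy H G c \<longleftrightarrow>
     (\<exists>f i. inj_on f (fst H) \<and> f ` fst H \<subseteq> fst G \<and>
            (\<forall>e\<in>snd H. f ` e \<in> snd G \<and> c (f ` e) = i))"

text \<open>
  In the two maxima below the edge counts are bounded by \<open>n choose 2\<close>, and the edgeless graph is
  admissible as soon as \<open>H\<close> has an edge (and \<open>\<rho> \<ge> 0\<close>).
\<close>

definition RT_mean :: "nat \<Rightarrow> 'b ugraph \<Rightarrow> real \<Rightarrow> nat" where
  "RT_mean n H \<rho> =
     Max {card (snd G) | G :: nat ugraph. simple_graph G \<and> card (fst G) = n \<and>
            (\<exists>c. mean_coloring \<rho> G c \<and> \<not> has_mono_copy H G c)}"

definition RT_colors :: "nat \<Rightarrow> 'b ugraph \<Rightarrow> nat \<Rightarrow> nat" where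
  "RT_colors n H k =
     Max {card (snd G) | G :: nat ugraph. simple_graph G \<and> card (fst G) = n \<and>
            (\<exists>c. at_most_colors k G c \<and> \<not> has_mono_copy H G c)}"

definition ramsey_number :: "'b ugraph \<Rightarrow> nat \<Rightarrow> nat" where
  "ramsey_number H k =
     (LEAST N. \<forall>c. at_most_colors k (complete_graph N) c \<longrightarrow> has_mono_copy H (complete_graph N) c)"

text \<open>
  The vertex classes are the fibres of \<open>p\<close>; some of them are empty if there are fewer than \<open>k\<close>
  vertices. Being as equal in size as possible means that the sizes differ by at most one.
\<close>

definition is_turan_graph :: "nat \<Rightarrow> 'a ugraph \<Rightarrow> bool" where
  "is_turan_graph k G \<longleftrightarrow> finite (fst G) \<and>
     (\<exists>p :: 'a \<Rightarrow> nat. p ` fst G \<subseteq> {..<k} \<and>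
        (\<forall>i<k. \<forall>j<k. card {v \<in> fst G. p v = i} \<le> card {v \<in> fst G. p v = j} + 1) \<and>
        snd G = {{u, v} | u v. u \<in> fst G \<and> v \<in> fst G \<and> p u \<noteq> p v})"

text \<open>For \<open>k \<ge> 1\<close> the Turan graph exists and is unique up to isomorphism.\<close>

definition turan_number :: "nat \<Rightarrow> nat \<Rightarrow> nat" where
  "turan_number n k =
     (THE m. \<exists>G :: nat ugraph. is_turan_graph k G \<and> card (fst G) = n \<and> card (snd G) = m)"

end

theory Submission
  imports Defs
begin

text \<open>
  A complete graph on six vertices in which every vertex sees at most two colors contains a
  monochromatic triangle, so by Turan's theorem a coloring with at most two colors at every vertex
  leaves at most \<open>2/5 * n ^ 2\<close> edges. When only the mean number of colors is bounded by two, vertices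
  with more colors, which allow larger cliques, have to be paid for by vertices with fewer colors. The
  right exchange rate is found by a weighted version of the Motzkin--Straus argument. Let \<open>k v\<close> be the
  number of colors at \<open>v\<close>, and for nonnegative vertex weights \<open>x\<close> of total 1 consider the sum of
  \<open>x u * x v\<close> over all ordered pairs of equal or non-adjacent vertices, plus \<open>3/10\<close> times the sum of
  \<open>(k v - 2) * x v\<close>. It suffices that this is always at least \<open>1/5\<close>: for the weights \<open>1 / n\<close> the linear
  part is at most 0 and the quadratic part is \<open>1 - 2 * e / n ^ 2\<close>, where \<open>e\<close> is the number of edges.

  Along a shift of weight between two non-adjacent vertices the form is linear, so its minimum is
  attained on a clique (\<open>quad_form_concentrate_on_clique\<close>). For a clique the form is a separable convex
  function of the weights, and Lagrange duality turns the bound into an inequality between the color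
  counts of its vertices (\<open>clique_cost\<close>). That inequality follows from two facts about cliques without
  monochromatic triangle: five vertices with at most two colors are possible only if there is no sixth
  vertex (\<open>five_two_colored_vertices_fill_clique\<close>), and a vertex with one color takes this color away
  from all other edges (\<open>clique_cost_monochromatic_vertex\<close>). The factor \<open>3/10\<close> is the largest one
  possible, because for a single edge with weights \<open>1/2\<close> at its ends it gives exactly \<open>1/5\<close>.

  Conversely, the 5-partite Turan graph has \<open>\<lfloor>2/5 * n ^ 2\<rfloor>\<close> edges, and the pentagon coloring of \<open>K\<^sub>5\<close>,
  blown up to it, uses at most two colors and has no monochromatic triangle. On five vertices the same
  coloring, together with the clique bound, gives \<open>R(K\<^sub>3, 2) = 6\<close>.
\<close>

section \<open>Shifting weights between non-adjacent vertices\<close>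

text \<open>
  For \<open>B\<close> the indicator of being equal or non-adjacent this is the Motzkin--Straus form: with all
  weights \<open>1 / n\<close> its quadratic part is \<open>1 - 2 * e / n ^ 2\<close> for a graph with \<open>e\<close> edges.
  The linear part will charge each vertex for its colors.
\<close>
definition quad_form :: "('a \<Rightarrow> 'a \<Rightarrow> real) \<Rightarrow> ('a \<Rightarrow> real) \<Rightarrow> 'a set \<Rightarrow> ('a \<Rightarrow> real) \<Rightarrow> real" where
  "quad_form B l V x = (\<Sum>a\<in>V. \<Sum>b\<in>V. B a b * x a * x b) + (\<Sum>a\<in>V. l a * x a)"

lemma quad_form_cong:
  assumes "\<And>a. a \<in> V \<Longrightarrow> x a = y a"
  shows "quad_form B l V x = quad_form B l V y"
  using assms by (simp add: quad_form_def cong: sum.cong)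

lemma quad_form_insert:
  assumes "finite V" "u \<notin> V" "\<And>a b. B a b = B b a"
  shows "quad_form B l (insert u V) x =
    quad_form B l V x + B u u * x u * x u + x u * (2 * (\<Sum>b\<in>V. B u b * x b) + l u)"
proof -
  have "(\<Sum>a\<in>V. B a u * x a * x u) = x u * (\<Sum>b\<in>V. B u b * x b)"
       "(\<Sum>b\<in>V. B u b * x u * x b) = x u * (\<Sum>b\<in>V. B u b * x b)"
    by (auto simp: sum_distrib_left assms(3)[of _ u] mult_ac intro!: sum.cong)
  then show ?thesis
    using assms(1,2) by (simp add: quad_form_def sum.distrib algebra_simps)
qed

text \<open>
  The weights of two non-adjacent vertices \<open>u\<close>, \<open>v\<close> contribute \<open>(x u + x v) ^ 2\<close>, which depends on
  their sum only, so along a shift of weight from \<open>u\<close> to \<open>v\<close> the form is linear. Hence all the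
  weight can be moved to the vertex with the smaller slope.
\<close>
lemma quad_form_shift:
  fixes B :: "'a \<Rightarrow> 'a \<Rightarrow> real"
  assumes R: "finite R" "u \<notin> R" "v \<notin> R" "u \<noteq> v"
    and B: "\<And>a b. B a b = B b a" "\<And>a. B a a = 1" "B u v = 1"
    and pos: "x u \<ge> 0"
    and le: "2 * (\<Sum>b\<in>R. B v b * x b) + l v \<le> 2 * (\<Sum>b\<in>R. B u b * x b) + l u"
  shows "quad_form B l (insert v R) (x(v := x u + x v)) \<le> quad_form B l (insert u (insert v R)) x"
proof -
  define K where "K = (\<Sum>b\<in>R. B v b * x b)"
  define L where "L = (\<Sum>b\<in>R. B u b * x b)"
  have K': "(\<Sum>b\<in>R. B v b * (x(v := x u + x v)) b) = K"
    unfolding K_def using R by (intro sum.cong) auto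
  have R': "quad_form B l R (x(v := x u + x v)) = quad_form B l R x"
    using R by (intro quad_form_cong) auto
  have 1: "quad_form B l (insert v R) (x(v := x u + x v)) =
      quad_form B l R x + (x u + x v)^2 + (x u + x v) * (2 * K + l v)"
    by (subst quad_form_insert[OF R(1,3) B(1)]) (simp add: B(2) K'[simplified] R' power2_eq_square)
  have 2: "quad_form B l (insert u (insert v R)) x = quad_form B l R x + (x u + x v)^2
      + x u * (2 * L + l u) + x v * (2 * K + l v)"
    using R by (simp add: quad_form_insert B K_def L_def power2_eq_square algebra_simps)
  have "x u * (2 * K + l v) \<le> x u * (2 * L + l u)"
    using le pos unfolding K_def L_def by (rule mult_left_mono)
  then show ?thesis unfolding 1 2 by (simp add: algebra_simps)
qed

text \<open>
  Each shift removes one vertex, and shifts are possible as long as two vertices are non-adjacent.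
\<close>
lemma quad_form_concentrate_on_clique:
  fixes B :: "'a \<Rightarrow> 'a \<Rightarrow> real"
  assumes "finite V"
    and B: "\<And>a b. B a b = B b a" "\<And>a. B a a = 1" "\<And>a b. B a b = 0 \<or> B a b = 1"
    and x: "\<And>a. a \<in> V \<Longrightarrow> x a \<ge> 0" "sum x V = 1"
  obtains W y where "W \<subseteq> V" "\<And>a. a \<in> W \<Longrightarrow> y a \<ge> 0" "sum y W = 1"
    "\<And>a b. a \<in> W \<Longrightarrow> b \<in> W \<Longrightarrow> a \<noteq> b \<Longrightarrow> B a b = 0"
    "quad_form B l W y \<le> quad_form B l V x"
proof -
  have "\<exists>W y. W \<subseteq> V \<and> (\<forall>a\<in>W. y a \<ge> 0) \<and> sum y W = 1 \<and>
      (\<forall>a\<in>W. \<forall>b\<in>W. a \<noteq> b \<longrightarrow> B a b = 0) \<and> quad_form B l W y \<le> quad_form B l V x"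
    using \<open>finite V\<close> x
  proof (induction V arbitrary: x rule: finite_psubset_induct)
    case (psubset V)
    show ?case
    proof (cases "\<forall>a\<in>V. \<forall>b\<in>V. a \<noteq> b \<longrightarrow> B a b = 0")
      case True
      with psubset.prems show ?thesis by (intro exI[of _ V] exI[of _ x]) auto
    next
      case False
      define s where "s R a = 2 * (\<Sum>b\<in>R. B a b * x b) + l a" for R a
      from False obtain a b where "a \<in> V" "b \<in> V" "a \<noteq> b" "B a b = 1"
        using B(3) by blast
      then have "B b a = 1" using B(1)[of a b] by simp
      (* Name the two vertices such that the slope at v is the smaller one. *)
      consider "s (V - {a,b}) b \<le> s (V - {a,b}) a" | "s (V - {b,a}) a \<le> s (V - {b,a}) b"
        using linear by (auto simp: insert_commute)
      then obtain u v where uv: "u \<in> V" "v \<in> V" "u \<noteq> v" "B u v = 1"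
          "s (V - {u,v}) v \<le> s (V - {u,v}) u"
        using \<open>a \<in> V\<close> \<open>b \<in> V\<close> \<open>a \<noteq> b\<close> \<open>B a b = 1\<close> \<open>B b a = 1\<close> by cases blast+
      define R where "R = V - {u, v}"
      define y where "y = x(v := x u + x v)"
      have R: "finite R" "u \<notin> R" "v \<notin> R" and V: "V = insert u (insert v R)"
        using psubset.hyps uv unfolding R_def by auto
      have le: "quad_form B l (insert v R) y \<le> quad_form B l V x"
        unfolding V y_def using R uv B psubset.prems
        by (intro quad_form_shift) (auto simp: s_def R_def)
      have ypos: "y a \<ge> 0" if "a \<in> insert v R" for a
        using that psubset.prems(1) by (auto simp: y_def V)
      have "sum y R = sum x R"
        using R by (intro sum.cong) (auto simp: y_def)
      then have "sum y (insert v R) = 1"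
        using psubset.prems(2) R uv by (simp add: V y_def)
      moreover have "insert v R \<subset> V" using R uv V by auto
      ultimately obtain W z where "W \<subseteq> insert v R \<and> (\<forall>a\<in>W. z a \<ge> 0) \<and> sum z W = 1 \<and>
          (\<forall>a\<in>W. \<forall>b\<in>W. a \<noteq> b \<longrightarrow> B a b = 0) \<and> quad_form B l W z \<le> quad_form B l (insert v R) y"
        using psubset.IH[of "insert v R" y] ypos by blast
      then show ?thesis using le V by (intro exI[of _ W] exI[of _ z]) auto
    qed
  qed
  then show ?thesis using that by blast
qed

section \<open>Cliques in which vertices see few colors\<close>

text \<open>
  Colors are recorded on a complete vertex set \<open>W\<close>, so no edge set is carried along.
\<close>
definition palette :: "('a set \<Rightarrow> nat) \<Rightarrow> 'a set \<Rightarrow> 'a \<Rightarrow> nat set" where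
  "palette c W v = (\<lambda>u. c {u, v}) ` (W - {v})"

definition no_mono_triangle :: "('a set \<Rightarrow> nat) \<Rightarrow> 'a set \<Rightarrow> bool" where
  "no_mono_triangle c W \<longleftrightarrow>
     (\<forall>p\<in>W. \<forall>q\<in>W. \<forall>r\<in>W. p \<noteq> q \<and> q \<noteq> r \<and> p \<noteq> r \<longrightarrow> \<not> (c {p, q} = c {q, r} \<and> c {q, r} = c {p, r}))"

lemma no_mono_triangle_subset: "no_mono_triangle c W \<Longrightarrow> U \<subseteq> W \<Longrightarrow> no_mono_triangle c U"
  unfolding no_mono_triangle_def by blast

lemma finite_palette [simp]: "finite W \<Longrightarrow> finite (palette c W v)"
  by (simp add: palette_def)

lemma palette_mono: "U \<subseteq> W \<Longrightarrow> palette c U v \<subseteq> palette c W v"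
  by (auto simp: palette_def)

lemma in_paletteI: "u \<in> W \<Longrightarrow> u \<noteq> v \<Longrightarrow> c {u, v} \<in> palette c W v"
  by (auto simp: palette_def)

lemma equal_remaining_color:
  assumes "finite A" "card A \<le> 2" "a \<in> A" "b \<in> A" "d \<in> A" "b \<noteq> a" "d \<noteq> a"
  shows "b = d"
proof (rule ccontr)
  assume "b \<noteq> d"
  then have "card {a, b, d} = 3" using assms by auto
  moreover have "card {a, b, d} \<le> card A" using assms by (intro card_mono) auto
  ultimately show False using assms by simp
qed

text \<open>
  The edges between the leaves of the star avoid its color \<open>a\<close>. A leaf with at most two colors sees \<open>a\<close> and
  therefore has just one color left for its edges to the other leaves; if two leaves are of this
  kind, the three leaves form a monochromatic triangle.
\<close>
lemma no_mono_star_of_three: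
  assumes W: "finite W" "no_mono_triangle c W"
    and mem: "u \<in> W" "p \<in> W" "q \<in> W" "r \<in> W"
    and ne: "p \<noteq> q" "p \<noteq> r" "q \<noteq> r" "u \<noteq> p" "u \<noteq> q" "u \<noteq> r"
    and star: "c {u, p} = a" "c {u, q} = a" "c {u, r} = a"
    and small: "card (palette c W p) \<le> 2" "card (palette c W q) \<le> 2"
  shows False
proof -
  have tri: "\<not> (c {x, y} = c {y, z} \<and> c {y, z} = c {x, z})"
    if "x \<in> W" "y \<in> W" "z \<in> W" "x \<noteq> y" "y \<noteq> z" "x \<noteq> z" for x y z
    using W(2) that unfolding no_mono_triangle_def by blast
  have avoid: "c {p, q} \<noteq> a" "c {p, r} \<noteq> a" "c {q, r} \<noteq> a"
    using tri[of u p q] tri[of u p r] tri[of u q r] mem ne star by auto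
  have "c {q, p} = c {r, p}"
    using avoid star in_paletteI[of u W p c] in_paletteI[of q W p c] in_paletteI[of r W p c] mem ne
    by (intro equal_remaining_color[OF finite_palette[OF W(1)] small(1), of a]) (auto simp: insert_commute)
  moreover have "c {p, q} = c {r, q}"
    using avoid star in_paletteI[of u W q c] in_paletteI[of p W q c] in_paletteI[of r W q c] mem ne
    by (intro equal_remaining_color[OF finite_palette[OF W(1)] small(2), of a]) (auto simp: insert_commute)
  ultimately show False using tri[of p q r] mem ne by (simp add: insert_commute)
qed

text \<open>
  The classical proof of \<open>R(3,3) \<le> 6\<close>, with the sixth vertex \<open>w\<close> allowed to see any number of
  colors: some vertex \<open>u \<noteq> w\<close> with at most two colors has three equally colored edges to the other five
  vertices, and at most one of their ends is \<open>w\<close>, so two of the ends see at most two colors.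
\<close>
lemma five_two_colored_vertices_fill_clique:
  assumes W: "finite W" "no_mono_triangle c W"
    and P: "P \<subseteq> W" "card P \<ge> 5" "\<And>p. p \<in> P \<Longrightarrow> card (palette c W p) \<le> 2"
  shows "card W \<le> 5"
proof (rule ccontr)
  assume "\<not> card W \<le> 5"
  then have card_W: "card W \<ge> 6" by simp
  obtain Q where Q: "Q \<subseteq> P" "card Q = 5" "finite Q"
    using obtain_subset_with_card_n[OF P(2)] by blast
  obtain u where u: "u \<in> Q" using Q by fastforce
  have "Q \<noteq> W" using Q card_W by auto
  then obtain w where w: "w \<in> W" "w \<notin> Q" using Q P by auto
  (* Five edges leave u, in at most two colors. *)
  define S where "S = insert w (Q - {u})"
  have S: "finite S" "card S = 5" "S \<subseteq> W" "u \<notin> S" "u \<in> W"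
    using Q u w P by (auto simp: S_def)
  define F where "F a = {s \<in> S. c {u, s} = a}" for a
  have "(\<lambda>s. c {s, u}) \<in> S \<rightarrow> palette c W u"
    using S by (auto intro!: in_paletteI)
  then have "\<exists>a\<in>palette c W u. card ((\<lambda>s. c {s, u}) -` {a} \<inter> S) * card (palette c W u) \<ge> card S"
    using S u w W in_paletteI[of w W u c] by (intro pigeonhole_card) auto
  then obtain a where "card ((\<lambda>s. c {s, u}) -` {a} \<inter> S) * card (palette c W u) \<ge> 5"
    using S by auto
  moreover have "(\<lambda>s. c {s, u}) -` {a} \<inter> S = F a"
    by (auto simp: F_def insert_commute)
  moreover have "card (F a) * card (palette c W u) \<le> card (F a) * 2"
    using P(3)[of u] u Q by (intro mult_left_mono) auto
  ultimately have "5 \<le> card (F a) * 2" by (metis order_trans)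
  then have a: "card (F a) \<ge> 3" by simp
  have fin: "finite (F a)" using S by (simp add: F_def)
  have "\<not> card (F a - {w}) \<le> Suc 0" using a fin by (simp add: card_Diff_singleton_if, linarith)
  then obtain p q where pq: "p \<in> F a - {w}" "q \<in> F a - {w}" "p \<noteq> q"
    using card_le_Suc0_iff_eq[OF finite_Diff[OF fin]] by blast
  have "F a - {p, q} \<noteq> {}"
  proof
    assume "F a - {p, q} = {}"
    then have "card (F a) \<le> card {p, q}" by (intro card_mono) auto
    then show False using a pq by simp
  qed
  then obtain r where r: "r \<in> F a" "r \<noteq> p" "r \<noteq> q" by auto
  have "p \<in> P" "q \<in> P" using pq Q by (auto simp: F_def S_def)
  then show False
    using no_mono_star_of_three[OF W, of u p q r a] P(3) pq r S
    by (auto simp: F_def)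
qed

corollary card_le_5_if_two_colored:
  assumes "finite W" "no_mono_triangle c W" "\<And>p. p \<in> W \<Longrightarrow> card (palette c W p) \<le> 2"
  shows "card W \<le> 5"
  using five_two_colored_vertices_fill_clique[OF assms(1,2) order_refl _ assms(3)] by fastforce

section \<open>A weighted inequality for colored cliques\<close>

text \<open>
  The maximum over \<open>x \<ge> 0\<close> of \<open>\<mu> * x - (x ^ 2 + 3/10 * (k - 2) * x)\<close>. Here \<open>\<mu>\<close> is a Lagrange multiplier
  for the constraint that the weights add up to 1; it may be chosen for each clique separately.
\<close>
definition cost :: "real \<Rightarrow> nat \<Rightarrow> real" where
  "cost \<mu> k = (max 0 (\<mu> - 3/10 * (real k - 2)))\<^sup>2 / 4"

lemma cost_antimono: "k \<le> m \<Longrightarrow> cost \<mu> m \<le> cost \<mu> k"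
  unfolding cost_def by (intro divide_right_mono power_mono max.mono) auto

lemma cost_tangent:
  assumes "x \<ge> 0"
  shows "x\<^sup>2 + 3/10 * (real k - 2) * x \<ge> \<mu> * x - cost \<mu> k"
proof (cases "\<mu> - 3/10 * (real k - 2) \<ge> 0")
  case True
  define t where "t = \<mu> - 3/10 * (real k - 2)"
  have "0 \<le> (x - t/2)\<^sup>2" by simp
  then have "x\<^sup>2 - t * x + t\<^sup>2/4 \<ge> 0" by (simp add: power2_eq_square field_simps)
  moreover have "cost \<mu> k = t\<^sup>2/4" using True by (simp add: cost_def t_def)
  ultimately show ?thesis by (simp add: t_def algebra_simps)
next
  case False
  then have "(\<mu> - 3/10 * (real k - 2)) * x \<le> 0" using assms by (intro mult_nonpos_nonneg) auto
  then have "\<mu> * x \<le> 3/10 * (real k - 2) * x" by (simp only: left_diff_distrib diff_le_0_iff_le)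
  moreover have "cost \<mu> k = 0" using False by (simp add: cost_def)
  moreover have "x\<^sup>2 \<ge> 0" by simp
  ultimately show ?thesis by linarith
qed

lemma cost_values:
  "cost (7/5) 0 = 1" "cost (7/10) 1 = 1/4" "cost (3/5) 1 = 81/400" "cost (3/5) 2 = 9/100"
  "cost (2/5) 1 = 49/400" "cost (2/5) 2 = 1/25" "cost (2/5) 3 = 1/400" "cost (2/5) 4 = 0"
  "cost (3/10) 2 = 9/400" "cost (3/10) 3 = 0"
  by (simp_all add: cost_def power2_eq_square)

lemma palette_one:
  assumes "finite W" "v \<in> W" "card (palette c W v) = 1"
  obtains i where "\<And>u. u \<in> W \<Longrightarrow> u \<noteq> v \<Longrightarrow> c {u, v} = i"
  using assms in_paletteI[of _ W v c] by (metis card_1_singletonE singletonD)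

lemma sum_cost_le:
  assumes "finite A" "card A \<le> m" "\<And>v. v \<in> A \<Longrightarrow> k v \<ge> j"
  shows "(\<Sum>v\<in>A. cost \<mu> (k v)) \<le> real m * cost \<mu> j"
proof -
  have "(\<Sum>v\<in>A. cost \<mu> (k v)) \<le> real (card A) * cost \<mu> j"
    using sum_bounded_above[of A "\<lambda>v. cost \<mu> (k v)" "cost \<mu> j"] assms cost_antimono by auto
  also have "\<dots> \<le> real m * cost \<mu> j"
    using assms by (intro mult_right_mono) (auto simp: cost_def)
  finally show ?thesis .
qed

text \<open>
  Let all edges at \<open>v\<close> have color \<open>i\<close>. Then no edge of \<open>W - {v}\<close> has color \<open>i\<close>, although every vertex
  there sees \<open>i\<close>; so it has one color less to use inside \<open>W - {v}\<close>. This leaves three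
  cases: a single edge, a triangle with color counts 1, 2, 2, or a larger clique. In the last one at
  most one vertex has two colors, by \<open>no_mono_star_of_three\<close> with center \<open>v\<close>, and at most five have
  three, since they use at most two colors among themselves.
\<close>
lemma clique_cost_monochromatic_vertex:
  assumes W: "finite W" "no_mono_triangle c W" "v \<in> W"
    and one: "card (palette c W v) = 1"
  shows "\<exists>\<mu>. (\<Sum>w\<in>W. cost \<mu> (card (palette c W w))) \<le> \<mu> - 1/5"
proof -
  define k where "k w = card (palette c W w)" for w
  obtain i where i: "\<And>u. u \<in> W \<Longrightarrow> u \<noteq> v \<Longrightarrow> c {u, v} = i"
    using palette_one[OF W(1,3) one] by blast
  have kv: "k v = 1" using one by (simp add: k_def)
  have i_mem: "i \<in> palette c W u" if "u \<in> W" "u \<noteq> v" for u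
    using in_paletteI[of v W u c] i[OF that] that W by (simp add: insert_commute)
  have not_i: "c {u, w} \<noteq> i" if "u \<in> W" "w \<in> W" "u \<noteq> v" "w \<noteq> v" "u \<noteq> w" for u w
  proof
    assume "c {u, w} = i"
    then have "c {u, w} = c {w, v} \<and> c {w, v} = c {u, v}" using i that by simp
    then show False using W that unfolding no_mono_triangle_def by blast
  qed
  have k1: "k u \<ge> 1" if "u \<in> W" "u \<noteq> v" for u
    using i_mem[OF that] W by (auto simp: k_def Suc_le_eq card_gt_0_iff)
  have k2: "k u \<ge> 2" if "u \<in> W" "w \<in> W" "u \<noteq> v" "w \<noteq> v" "u \<noteq> w" for u w
  proof -
    have "{i, c {w, u}} \<subseteq> palette c W u" using i_mem in_paletteI[of w W u c] that by auto
    then have "card {i, c {w, u}} \<le> k u" unfolding k_def using W by (intro card_mono) auto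
    then show ?thesis using not_i[of w u] that by (auto simp: card_insert_if split: if_splits)
  qed
  have split: "(\<Sum>w\<in>W. cost \<mu> (k w)) = cost \<mu> 1 + (\<Sum>w\<in>W - {v}. cost \<mu> (k w))" for \<mu>
    using W kv by (simp add: sum.remove)
  (* The multipliers below are rational points near the optimum of each case; for a single edge
     7/10 is the optimum and the inequality is an equality. *)
  consider (two) "card (W - {v}) \<le> 1"
    | (three) p q where "W = {v, p, q}" "p \<noteq> q" "p \<noteq> v" "q \<noteq> v"
    | (many) "card (W - {v}) \<ge> 2" "card {w \<in> W - {v}. k w \<le> 2} \<le> 1"
  proof -
    have "card (W - {v}) \<le> 1 \<or> card {w \<in> W - {v}. k w \<le> 2} \<le> 1 \<or>
        (\<exists>p q. W = {v, p, q} \<and> p \<noteq> q \<and> p \<noteq> v \<and> q \<noteq> v)"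
    proof (cases "card {w \<in> W - {v}. k w \<le> 2} \<le> 1")
      case False
      then obtain p q where pq: "p \<in> W - {v}" "q \<in> W - {v}" "k p \<le> 2" "k q \<le> 2" "p \<noteq> q"
        using card_le_Suc0_iff_eq[of "{w \<in> W - {v}. k w \<le> 2}"] W by auto
      have "r \<in> {v, p, q}" if "r \<in> W" for r
        using no_mono_star_of_three[OF W(1,2), of v p q r i] pq that i W
        by (auto simp: k_def insert_commute)
      then have "W = {v, p, q}" using pq W by blast
      then show ?thesis using pq by blast
    qed auto
    then show ?thesis using that by fastforce
  qed
  then have "\<exists>\<mu>. (\<Sum>w\<in>W. cost \<mu> (k w)) \<le> \<mu> - 1/5"
  proof cases
    case two
    have "(\<Sum>w\<in>W - {v}. cost (7/10) (k w)) \<le> real 1 * cost (7/10) 1"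
      using two k1 W by (intro sum_cost_le) auto
    then show ?thesis unfolding split by (intro exI[of _ "7/10"]) (simp only: cost_values)
  next
    case three
    have "(\<Sum>w\<in>W - {v}. cost (3/5) (k w)) \<le> real 2 * cost (3/5) 2"
      using three k2[of p q] k2[of q p] W by (intro sum_cost_le) (auto simp: card_insert_if)
    then show ?thesis unfolding split by (intro exI[of _ "3/5"]) (simp only: cost_values)
  next
    case many
    define Y where "Y = {w \<in> W - {v}. k w \<le> 2}"
    define Z where "Z = {w \<in> W - {v}. k w = 3}"
    define X where "X = {w \<in> W - {v}. k w \<ge> 4}"
    have fin: "finite Y" "finite Z" "finite X" using W by (auto simp: X_def Y_def Z_def)
    have "k u \<ge> 2" if u: "u \<in> W - {v}" for u
    proof -
      have "W - {v} \<noteq> {u}"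
      proof
        assume "W - {v} = {u}"
        then show False using many(1) by simp
      qed
      then obtain w where "w \<in> W - {v}" "w \<noteq> u" using u by blast
      then show ?thesis using k2[of u w] u by auto
    qed
    then have Y: "(\<Sum>w\<in>Y. cost (2/5) (k w)) \<le> real 1 * cost (2/5) 2"
      using many fin by (intro sum_cost_le) (auto simp: Y_def)
    have "card Z \<le> 5"
    proof (rule card_le_5_if_two_colored)
      show "no_mono_triangle c Z" using no_mono_triangle_subset[OF W(2)] by (auto simp: Z_def)
      fix p assume p: "p \<in> Z"
      have "palette c Z p \<subseteq> palette c W p" by (intro palette_mono) (auto simp: Z_def)
      moreover have "i \<notin> palette c Z p"
        using not_i[of _ p] p by (auto simp: palette_def Z_def)
      ultimately have "palette c Z p \<subseteq> palette c W p - {i}" by blast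
      then have "card (palette c Z p) \<le> card (palette c W p - {i})"
        using W by (intro card_mono) auto
      also have "\<dots> = 2" using p i_mem[of p] by (simp add: card_Diff_singleton_if Z_def k_def)
      finally show "card (palette c Z p) \<le> 2" .
    qed (use fin in auto)
    then have Z: "(\<Sum>w\<in>Z. cost (2/5) (k w)) \<le> real 5 * cost (2/5) 3"
      using fin by (intro sum_cost_le) (auto simp: Z_def)
    have X: "(\<Sum>w\<in>X. cost (2/5) (k w)) \<le> real (card X) * cost (2/5) 4"
      using fin by (intro sum_cost_le) (auto simp: X_def)
    have "W - {v} = Y \<union> (Z \<union> X)" "Z \<inter> X = {}" "Y \<inter> (Z \<union> X) = {}"
      by (auto simp: X_def Y_def Z_def)
    then have "(\<Sum>w\<in>W - {v}. cost (2/5) (k w)) =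
        (\<Sum>w\<in>Y. cost (2/5) (k w)) + ((\<Sum>w\<in>Z. cost (2/5) (k w)) + (\<Sum>w\<in>X. cost (2/5) (k w)))"
      using fin by (simp add: sum.union_disjoint)
    then show ?thesis using X Y Z
      unfolding split by (intro exI[of _ "2/5"]) (simp only: cost_values)
  qed
  then show ?thesis by (simp add: k_def)
qed

text \<open>
  By duality this is the weighted inequality for cliques, with a multiplier \<open>\<mu>\<close> that suits the
  clique. If every vertex sees two colors or more, either there are at most five vertices, or at most
  four of them see only two colors while the others cost nothing at \<open>\<mu> = 3/10\<close>.
\<close>
lemma clique_cost:
  assumes W: "finite W" "W \<noteq> {}" "no_mono_triangle c W"
  shows "\<exists>\<mu>. (\<Sum>w\<in>W. cost \<mu> (card (palette c W w))) \<le> \<mu> - 1/5"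
proof -
  define k where "k w = card (palette c W w)" for w
  consider (zero) v where "v \<in> W" "k v = 0" | (one) v where "v \<in> W" "k v = 1"
    | (two) "\<And>v. v \<in> W \<Longrightarrow> k v \<ge> 2"
  proof -
    have "k v = 0 \<or> k v = 1 \<or> k v \<ge> 2" for v by linarith
    then show ?thesis using that by blast
  qed
  then have "\<exists>\<mu>. (\<Sum>w\<in>W. cost \<mu> (k w)) \<le> \<mu> - 1/5"
  proof cases
    case zero
    then have "W = {v}" using W by (auto simp: k_def palette_def)
    then show ?thesis using zero
      by (intro exI[of _ "7/5"]) (simp add: cost_values)
  next
    case one
    then show ?thesis using clique_cost_monochromatic_vertex[OF W(1,3)] by (simp add: k_def)
  next
    case two
    show ?thesis
    proof (cases "card W \<le> 5")
      case True
      then have "(\<Sum>w\<in>W. cost (2/5) (k w)) \<le> real 5 * cost (2/5) 2"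
        using two W by (intro sum_cost_le) auto
      then show ?thesis by (intro exI[of _ "2/5"]) (simp add: cost_values)
    next
      case False
      define Y where "Y = {w \<in> W. k w \<le> 2}"
      have "card Y \<le> 4"
      proof (rule ccontr)
        assume "\<not> card Y \<le> 4"
        then have "card W \<le> 5"
          using W by (intro five_two_colored_vertices_fill_clique[of W c Y]) (auto simp: Y_def k_def)
        then show False using False by simp
      qed
      then have "(\<Sum>w\<in>Y. cost (3/10) (k w)) \<le> real 4 * cost (3/10) 2"
        using two W by (intro sum_cost_le) (auto simp: Y_def)
      moreover have "(\<Sum>w\<in>W - Y. cost (3/10) (k w)) \<le> real (card (W - Y)) * cost (3/10) 3"
        using W by (intro sum_cost_le) (auto simp: Y_def)
      moreover have "(\<Sum>w\<in>W. cost (3/10) (k w)) =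
          (\<Sum>w\<in>W - Y. cost (3/10) (k w)) + (\<Sum>w\<in>Y. cost (3/10) (k w))"
        using W by (intro sum.subset_diff) (auto simp: Y_def)
      ultimately show ?thesis by (intro exI[of _ "3/10"]) (simp add: cost_values)
    qed
  qed
  then show ?thesis by (simp add: k_def)
qed

text \<open>
  A vertex of a clique in a larger graph may see further colors outside the clique; this is why the
  linear term has some \<open>k v\<close> above the size of the palette.
\<close>
lemma clique_inequality:
  assumes W: "finite W" "no_mono_triangle c W"
    and x: "\<And>v. v \<in> W \<Longrightarrow> x v \<ge> 0" "sum x W = 1"
    and k: "\<And>v. v \<in> W \<Longrightarrow> card (palette c W v) \<le> k v"
  shows "(\<Sum>v\<in>W. (x v)\<^sup>2 + 3/10 * (real (k v) - 2) * x v) \<ge> 1/5"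
proof -
  have "W \<noteq> {}" using x(2) by auto
  then obtain \<mu> where \<mu>: "(\<Sum>w\<in>W. cost \<mu> (card (palette c W w))) \<le> \<mu> - 1/5"
    using clique_cost[OF W(1) _ W(2)] by blast
  have "1/5 \<le> \<mu> * sum x W - (\<Sum>w\<in>W. cost \<mu> (card (palette c W w)))"
    using \<mu> x(2) by simp
  also have "\<dots> \<le> \<mu> * sum x W - (\<Sum>w\<in>W. cost \<mu> (k w))"
    using k by (simp add: sum_mono cost_antimono)
  also have "\<dots> = (\<Sum>v\<in>W. \<mu> * x v - cost \<mu> (k v))"
    by (simp add: sum_subtractf sum_distrib_left)
  also have "\<dots> \<le> (\<Sum>v\<in>W. (x v)\<^sup>2 + 3/10 * (real (k v) - 2) * x v)"
    using x(1) by (intro sum_mono cost_tangent) auto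
  finally show ?thesis .
qed

section \<open>The edge bound for 2-mean colorings\<close>

lemma handshake:
  assumes "finite V" "E \<subseteq> [V]\<^bsup>2\<^esup>"
  shows "card {(u, v) \<in> V \<times> V. {u, v} \<in> E} = 2 * card E"
proof -
  have fin: "finite E" by (rule finite_subset[OF assms(2) finite_imp_finite_nsets[OF assms(1)]])
  define D where "D e = {(u, v) \<in> V \<times> V. {u, v} = e}" for e
  have D: "card (D e) = 2" if "e \<in> E" for e
  proof -
    have "e \<in> [V]\<^bsup>2\<^esup>" using assms(2) that by blast
    then obtain x y where xy: "e = {x, y}" "x \<in> V" "y \<in> V" "x \<noteq> y"
      by (rule nsets2_E)
    then have "D e = {(x, y), (y, x)}" by (auto simp: D_def doubleton_eq_iff)
    then show ?thesis using xy by simp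
  qed
  have finD: "finite (D e)" for e
    by (rule finite_subset[of _ "V \<times> V"]) (use assms(1) in \<open>auto simp: D_def\<close>)
  have "{(u, v) \<in> V \<times> V. {u, v} \<in> E} = (\<Union>e\<in>E. D e)" by (auto simp: D_def)
  moreover have "card (\<Union>e\<in>E. D e) = (\<Sum>e\<in>E. card (D e))"
    using fin finD by (intro card_UN_disjoint) (auto simp: D_def)
  ultimately show ?thesis using D by simp
qed

lemma has_mono_copy_K3_iff:
  "has_mono_copy (complete_graph 3) G c \<longleftrightarrow>
     (\<exists>p\<in>fst G. \<exists>q\<in>fst G. \<exists>r\<in>fst G. p \<noteq> q \<and> q \<noteq> r \<and> p \<noteq> r \<and> {p, q} \<in> snd G \<and> {q, r} \<in> snd G \<and>
        {p, r} \<in> snd G \<and> c {p, q} = c {q, r} \<and> c {q, r} = c {p, r})" (is "_ \<longleftrightarrow> ?R")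
proof
  assume "has_mono_copy (complete_graph 3) G c"
  then obtain f i where f: "inj_on f {..<3::nat}" "f ` {..<3} \<subseteq> fst G"
    and e: "\<And>e. e \<in> [{..<3}]\<^bsup>2\<^esup> \<Longrightarrow> f ` e \<in> snd G \<and> c (f ` e) = i"
    by (auto simp: has_mono_copy_def complete_graph_def)
  have "f 0 \<noteq> f 1" "f 1 \<noteq> f 2" "f 0 \<noteq> f 2"
    using inj_onD[OF f(1), of 0 1] inj_onD[OF f(1), of 1 2] inj_onD[OF f(1), of 0 2] by auto
  moreover have "f 0 \<in> fst G" "f 1 \<in> fst G" "f 2 \<in> fst G"
    using f(2) by auto
  moreover have "{f 0, f 1} \<in> snd G \<and> c {f 0, f 1} = i" "{f 1, f 2} \<in> snd G \<and> c {f 1, f 2} = i"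
      "{f 0, f 2} \<in> snd G \<and> c {f 0, f 2} = i"
    using e[of "{0,1}"] e[of "{1,2}"] e[of "{0,2}"] by simp_all
  ultimately show ?R by metis
next
  assume ?R
  then obtain p q r where pqr: "p \<in> fst G" "q \<in> fst G" "r \<in> fst G" "p \<noteq> q" "q \<noteq> r" "p \<noteq> r"
    "{p, q} \<in> snd G" "{q, r} \<in> snd G" "{p, r} \<in> snd G" "c {p, q} = c {q, r}" "c {q, r} = c {p, r}"
    by blast
  define f where "f j = (if j = 0 then p else if j = 1 then q else r)" for j :: nat
  have 3: "{..<3::nat} = {0, 1, 2}" by auto
  have "inj_on f {..<3}" using pqr by (auto simp: 3 f_def inj_on_def)
  moreover have "f ` {..<3} \<subseteq> fst G" using pqr by (auto simp: f_def)
  moreover have "f ` e \<in> snd G \<and> c (f ` e) = c {p, q}" if "e \<in> [{..<3}]\<^bsup>2\<^esup>" for e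
  proof -
    have "e \<in> {{0,1}, {1,2}, {0,2}}" using that by (auto simp: 3 nsets_2_eq)
    then consider "e = {0,1}" | "e = {1,2}" | "e = {0,2}" by blast
    then show ?thesis by cases (simp_all add: f_def pqr insert_commute)
  qed
  ultimately show "has_mono_copy (complete_graph 3) G c"
    unfolding has_mono_copy_def complete_graph_def fst_conv snd_conv
    by (intro exI[of _ f] exI[of _ "c {p, q}"]) simp
qed

lemma no_mono_triangle_if_clique:
  assumes "\<not> has_mono_copy (complete_graph 3) G c" "W \<subseteq> fst G"
    and "\<And>a b. a \<in> W \<Longrightarrow> b \<in> W \<Longrightarrow> a \<noteq> b \<Longrightarrow> {a, b} \<in> snd G"
  shows "no_mono_triangle c W"
  using assms unfolding has_mono_copy_K3_iff no_mono_triangle_def by blast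

lemma palette_subset_incident_colors:
  assumes "v \<in> W" "\<And>a b. a \<in> W \<Longrightarrow> b \<in> W \<Longrightarrow> a \<noteq> b \<Longrightarrow> {a, b} \<in> snd G"
  shows "palette c W v \<subseteq> incident_colors G c v"
  using assms by (auto simp: palette_def incident_colors_def)

lemma finite_edges:
  assumes "simple_graph G"
  shows "finite (snd G)"
proof (rule finite_subset)
  show "snd G \<subseteq> [fst G]\<^bsup>2\<^esup>" using assms by (simp add: simple_graph_def)
  show "finite ([fst G]\<^bsup>2\<^esup>)" using assms by (simp add: simple_graph_def finite_imp_finite_nsets)
qed

text \<open>
  With all weights \<open>1 / n\<close> the linear term is nonpositive by the mean condition, so the form is at most
  \<open>1 - 2 * e / n ^ 2\<close>. After concentration on a clique it is at least \<open>1/5\<close>.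
\<close>
theorem two_mean_edge_bound:
  assumes G: "simple_graph G" "fst G \<noteq> {}"
    and mean: "mean_coloring 2 G c"
    and no_mono: "\<not> has_mono_copy (complete_graph 3) G c"
  shows "real (card (snd G)) \<le> 2/5 * (real (card (fst G)))\<^sup>2"
proof -
  define V where "V = fst G"
  define E where "E = snd G"
  define n where "n = real (card V)"
  define k where "k v = card (incident_colors G c v)" for v
  define B where "B u v = (if {u, v} \<in> E then 0 else 1 :: real)" for u v
  define l where "l v = 3/10 * (real (k v) - 2)" for v
  have fin: "finite V" "E \<subseteq> [V]\<^bsup>2\<^esup>" using G by (auto simp: simple_graph_def V_def E_def)
  have n: "n > 0" using G fin by (simp add: n_def V_def card_gt_0_iff)
  have Bdiag: "B a a = 1" for a using fin(2) by (auto simp: B_def nsets_def)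
  obtain W y where W: "W \<subseteq> V" "\<And>a. a \<in> W \<Longrightarrow> y a \<ge> 0" "sum y W = 1"
    and clique: "\<And>a b. a \<in> W \<Longrightarrow> b \<in> W \<Longrightarrow> a \<noteq> b \<Longrightarrow> B a b = 0"
    and le: "quad_form B l W y \<le> quad_form B l V (\<lambda>_. 1 / n)"
    using n fin Bdiag
    by (elim quad_form_concentrate_on_clique[of V B "\<lambda>_. 1/n" l, rotated -1])
       (auto simp: B_def insert_commute n_def)
  have finW: "finite W" using W fin finite_subset by blast
  have edge: "{a, b} \<in> E" if "a \<in> W" "b \<in> W" "a \<noteq> b" for a b
    using clique[OF that] by (auto simp: B_def split: if_splits)
  have nomono: "no_mono_triangle c W"
    using no_mono edge W(1) by (intro no_mono_triangle_if_clique) (auto simp: V_def E_def)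
  have pal: "card (palette c W v) \<le> k v" if "v \<in> W" for v
    unfolding k_def using that edge finite_edges[OF G(1)]
    by (intro card_mono palette_subset_incident_colors) (auto simp: incident_colors_def E_def)
  (* On a clique only the diagonal of B survives. *)
  have "(\<Sum>b\<in>W. B a b * y a * y b) = (y a)\<^sup>2" if "a \<in> W" for a
  proof -
    have "(\<Sum>b\<in>W. B a b * y a * y b) = (\<Sum>b\<in>W. if b = a then (y a)\<^sup>2 else 0)"
      using that clique Bdiag by (intro sum.cong) (auto simp: power2_eq_square)
    then show ?thesis using that finW by simp
  qed
  then have "quad_form B l W y = (\<Sum>v\<in>W. (y v)\<^sup>2 + 3/10 * (real (k v) - 2) * y v)"
    by (simp add: quad_form_def l_def sum.distrib)
  also have "\<dots> \<ge> 1/5"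
    using clique_inequality[of W c y k] finW nomono W pal by blast
  finally have low: "1/5 \<le> quad_form B l V (\<lambda>_. 1 / n)" using le by linarith
  have "(\<Sum>a\<in>V. \<Sum>b\<in>V. B a b) = (\<Sum>a\<in>V. \<Sum>b\<in>V. 1 - of_bool ({a, b} \<in> E))"
    by (intro sum.cong) (auto simp: B_def)
  also have "\<dots> = n\<^sup>2 - (\<Sum>(a, b)\<in>V \<times> V. of_bool ({a, b} \<in> E))"
    by (simp add: sum_subtractf n_def power2_eq_square sum.cartesian_product)
  also have "(\<Sum>(a, b)\<in>V \<times> V. of_bool ({a, b} \<in> E)) =
      real (card {(a, b) \<in> V \<times> V. {a, b} \<in> E})"
    using fin by (simp add: case_prod_unfold sum_of_bool_eq Int_def mem_Times_iff)
  also have "\<dots> = 2 * real (card E)" by (simp only: handshake[OF fin] of_nat_mult of_nat_numeral)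
  finally have BE: "(\<Sum>a\<in>V. \<Sum>b\<in>V. B a b) = n\<^sup>2 - 2 * real (card E)" .
  have "(\<Sum>v\<in>V. real (k v)) \<le> 2 * n"
    using mean n by (simp add: mean_coloring_def k_def V_def n_def field_simps)
  then have lin: "(\<Sum>v\<in>V. l v) \<le> 0"
    by (simp add: l_def sum_subtractf n_def flip: sum_distrib_left sum_divide_distrib)
  have "quad_form B l V (\<lambda>_. 1 / n) = (\<Sum>a\<in>V. \<Sum>b\<in>V. B a b) / n\<^sup>2 + (\<Sum>v\<in>V. l v) / n"
    by (simp add: quad_form_def sum_divide_distrib power2_eq_square)
  also have "\<dots> \<le> (n\<^sup>2 - 2 * real (card E)) / n\<^sup>2"
    using lin n by (simp add: BE divide_nonpos_pos)
  finally have "1/5 \<le> (n\<^sup>2 - 2 * real (card E)) / n\<^sup>2" using low by linarith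
  then have "1/5 * n\<^sup>2 \<le> n\<^sup>2 - 2 * real (card E)"
    using n by (simp add: pos_le_divide_eq)
  then show ?thesis by (simp add: V_def E_def n_def)
qed

section \<open>The number of edges of the 5-partite Turan graph\<close>

text \<open>
  With \<open>k\<close> classes of size \<open>q + 1\<close> and \<open>5 - k\<close> classes of size \<open>q\<close>, the difference between
  \<open>2/5 * n ^ 2\<close> and the number \<open>m\<close> of edges is \<open>k * (5 - k) / 10\<close>, which is less than 1.
\<close>
lemma balanced_sum_squares:
  fixes N :: "nat \<Rightarrow> int"
  assumes balanced: "\<And>i j. i < 5 \<Longrightarrow> j < 5 \<Longrightarrow> N i \<le> N j + 1"
    and n: "n = (\<Sum>i<5. N i)"
    and m: "2 * m = n\<^sup>2 - (\<Sum>i<5. (N i)\<^sup>2)"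
  shows "5 * m \<le> 2 * n\<^sup>2" "2 * n\<^sup>2 < 5 * m + 5"
proof -
  define q where "q = Min (N ` {..<5})"
  define d where "d i = N i - q" for i
  define k where "k = (\<Sum>i<5. d i)"
  (* Every class has size q or q + 1, so d takes the values 0 and 1 only. *)
  have "q \<in> N ` {..<5}" unfolding q_def by (intro Min_in) (auto simp: lessThan_empty_iff)
  then obtain j where "j < 5" "q = N j" by auto
  moreover have "q \<le> N i" if "i < 5" for i unfolding q_def using that by (intro Min_le) auto
  ultimately have d: "0 \<le> d i" "d i \<le> 1" if "i < 5" for i
    using balanced[of i j] that by (auto simp: d_def)
  have d_sq: "(d i)\<^sup>2 = d i" if "i < 5" for i
  proof -
    have "d i = 0 \<or> d i = 1" using d[OF that] by linarith
    then show ?thesis by auto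
  qed
  have k: "0 \<le> k" "k \<le> 5"
    using sum_bounded_above[of "{..<5::nat}" d 1] d by (auto simp: k_def intro!: sum_nonneg)
  have nk: "n = 5 * q + k" by (simp add: n k_def d_def sum_subtractf)
  have "(\<Sum>i<5. (N i)\<^sup>2) = (\<Sum>i<5. q\<^sup>2 + 2 * q * d i + d i)"
  proof (rule sum.cong)
    fix i :: nat assume "i \<in> {..<5}"
    then have "(N i)\<^sup>2 = q\<^sup>2 + 2 * q * d i + (d i)\<^sup>2"
      by (simp add: d_def power2_eq_square algebra_simps)
    then show "(N i)\<^sup>2 = q\<^sup>2 + 2 * q * d i + d i" using d_sq \<open>i \<in> {..<5}\<close> by simp
  qed simp
  also have "\<dots> = 5 * q\<^sup>2 + 2 * q * k + k"
    by (simp add: k_def sum.distrib sum_distrib_left)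
  finally have "4 * n\<^sup>2 - 10 * m = k * (5 - k)"
    using m by (simp add: nk power2_eq_square algebra_simps)
  moreover have "0 \<le> k * (5 - k)" using k by simp
  moreover have "4 * (k * (5 - k)) \<le> 25"
    using zero_le_power2[of "2 * k - 5"] by (simp add: power2_eq_square algebra_simps)
  ultimately show "5 * m \<le> 2 * n\<^sup>2" "2 * n\<^sup>2 < 5 * m + 5" by linarith+
qed

lemma turan_graph_edges:
  assumes "is_turan_graph 5 G"
  shows "int (card (snd G)) = \<lfloor>0.4 * (real (card (fst G)))\<^sup>2\<rfloor>"
proof -
  define V where "V = fst G"
  obtain p where fin: "finite V" and p: "p ` V \<subseteq> {..<5::nat}"
    and bal: "\<And>i j. i < 5 \<Longrightarrow> j < 5 \<Longrightarrow> card {v \<in> V. p v = i} \<le> card {v \<in> V. p v = j} + 1"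
    and E: "snd G = {{u, v} | u v. u \<in> V \<and> v \<in> V \<and> p u \<noteq> p v}"
    using assms by (auto simp: is_turan_graph_def V_def)
  define N where "N i = int (card {v \<in> V. p v = i})" for i
  have N: "N i \<le> N j + 1" if "i < 5" "j < 5" for i j
    using bal[OF that] by (simp add: N_def)
  have V: "V = (\<Union>i<5. {v \<in> V. p v = i})" using p by auto
  have "card V = (\<Sum>i<5. card {v \<in> V. p v = i})"
    by (subst V, intro card_UN_disjoint) (use fin in auto)
  then have n: "int (card V) = (\<Sum>i<5. N i)"
    by (simp add: N_def)
  (* The ordered pairs that are left over, those in different classes, count each edge twice. *)
  have same: "{(u, v) \<in> V \<times> V. p u = p v} = (\<Union>i<5. {v \<in> V. p v = i} \<times> {v \<in> V. p v = i})"
    using p by auto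
  have "card {(u, v) \<in> V \<times> V. p u = p v} = (\<Sum>i<5. card ({v \<in> V. p v = i} \<times> {v \<in> V. p v = i}))"
    unfolding same by (intro card_UN_disjoint) (use fin in auto)
  then have sq: "int (card {(u, v) \<in> V \<times> V. p u = p v}) =
      (\<Sum>i<5. (N i)\<^sup>2)"
    by (simp add: N_def card_cartesian_product power2_eq_square)
  have sub: "snd G \<subseteq> [V]\<^bsup>2\<^esup>" by (auto simp: E)
  have "{(u, v) \<in> V \<times> V. {u, v} \<in> snd G} = V \<times> V - {(u, v) \<in> V \<times> V. p u = p v}"
    by (auto simp: E doubleton_eq_iff)
  then have "2 * card (snd G) = card (V \<times> V - {(u, v) \<in> V \<times> V. p u = p v})"
    by (simp flip: handshake[OF fin sub])
  also have "int \<dots> = int (card (V \<times> V)) - int (card {(u, v) \<in> V \<times> V. p u = p v})"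
  proof -
    define D where "D = {(u, v) \<in> V \<times> V. p u = p v}"
    have D: "D \<subseteq> V \<times> V" "finite D"
      using fin finite_subset[of D "V \<times> V"] by (auto simp: D_def)
    then have "int (card (V \<times> V - D)) = int (card (V \<times> V)) - int (card D)"
      using card_Diff_subset[OF D(2,1)] card_mono[OF _ D(1)] fin by (simp add: of_nat_diff)
    then show ?thesis unfolding D_def .
  qed
  finally have m: "2 * int (card (snd G)) = (int (card V))\<^sup>2 -
      (\<Sum>i<5. (N i)\<^sup>2)"
    by (simp only: sq card_cartesian_product power2_eq_square of_nat_mult of_nat_numeral)
  have "5 * int (card (snd G)) \<le> 2 * (int (card V))\<^sup>2"
       "2 * (int (card V))\<^sup>2 < 5 * int (card (snd G)) + 5"
    by (rule balanced_sum_squares[OF N n m]; assumption)+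
  then have "real_of_int (5 * int (card (snd G))) \<le> real_of_int (2 * (int (card V))\<^sup>2)"
       "real_of_int (2 * (int (card V))\<^sup>2) < real_of_int (5 * int (card (snd G)) + 5)"
    by (simp_all only: of_int_le_iff of_int_less_iff)
  then have "\<lfloor>0.4 * (real (card V))\<^sup>2\<rfloor> = int (card (snd G))"
    by (intro floor_unique) auto
  then show ?thesis by (simp add: V_def)
qed

lemma card_residue_class:
  "i < 5 \<Longrightarrow> card {v::nat. v < n \<and> v mod 5 = i} = n div 5 + of_bool (i < n mod 5)"
proof (induction n)
  case (Suc n)
  have "{v. v < Suc n \<and> v mod 5 = i} =
      (if n mod 5 = i then insert n {v. v < n \<and> v mod 5 = i} else {v. v < n \<and> v mod 5 = i})"
    by (auto simp: less_Suc_eq)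
  then have "card {v. v < Suc n \<and> v mod 5 = i} =
      n div 5 + of_bool (i < n mod 5) + of_bool (i = n mod 5)"
    using Suc by simp
  also have "\<dots> = Suc n div 5 + of_bool (i < Suc n mod 5)"
    using Suc.prems by (auto simp: div_Suc mod_Suc less_Suc_eq)
  finally show ?case .
qed simp

definition turan5 :: "nat \<Rightarrow> nat ugraph" where
  "turan5 n = ({..<n}, {{u, v} | u v. u < n \<and> v < n \<and> u mod 5 \<noteq> v mod 5})"

lemma turan5_is_turan_graph: "is_turan_graph 5 (turan5 n)"
proof -
  have "card {v \<in> {..<n}. v mod 5 = i} \<le> card {v \<in> {..<n}. v mod 5 = j} + 1" if "i < 5" "j < 5" for i j
    using card_residue_class[of i n] card_residue_class[of j n] that by simp
  then show ?thesis
    unfolding is_turan_graph_def turan5_def by (intro conjI exI[of _ "\<lambda>v. v mod 5"]) auto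
qed

lemma simple_graph_turan5: "simple_graph (turan5 n)"
  by (auto simp: simple_graph_def turan5_def)

lemma turan_number_5: "int (turan_number n 5) = \<lfloor>0.4 * (real n)\<^sup>2\<rfloor>"
  and card_edges_turan5: "card (snd (turan5 n)) = turan_number n 5"
proof -
  have n: "card (fst (turan5 n)) = n" by (simp add: turan5_def)
  have e: "int (card (snd (turan5 n))) = \<lfloor>0.4 * (real n)\<^sup>2\<rfloor>"
    using turan_graph_edges[OF turan5_is_turan_graph] by (simp add: n)
  show "card (snd (turan5 n)) = turan_number n 5"
    unfolding turan_number_def
  proof (rule the_equality[symmetric])
    show "\<exists>G :: nat ugraph. is_turan_graph 5 G \<and> card (fst G) = n \<and> card (snd G) = card (snd (turan5 n))"
      using turan5_is_turan_graph n by blast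
    fix m assume "\<exists>G :: nat ugraph. is_turan_graph 5 G \<and> card (fst G) = n \<and> card (snd G) = m"
    then show "m = card (snd (turan5 n))" using turan_graph_edges e by fastforce
  qed
  then show "int (turan_number n 5) = \<lfloor>0.4 * (real n)\<^sup>2\<rfloor>" using e by simp
qed

section \<open>The pentagon coloring\<close>

text \<open>
  Both the pentagon and its complement, the pentagram, are free of triangles. Hence coloring the edges
  of a complete 5-partite graph by whether the classes of their ends are adjacent in the pentagon
  leaves no monochromatic triangle.
\<close>
definition pentagon_adjacent :: "nat \<Rightarrow> nat \<Rightarrow> bool" where
  "pentagon_adjacent a b \<longleftrightarrow> b = (a + 1) mod 5 \<or> a = (b + 1) mod 5"

lemma pentagon_and_complement_triangle_free:
  assumes "a < 5" "b < 5" "d < 5" "a \<noteq> b" "b \<noteq> d" "a \<noteq> d"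
  shows "\<not> (pentagon_adjacent a b = pentagon_adjacent b d \<and>
            pentagon_adjacent b d = pentagon_adjacent a d)"
proof -
  have lt5: "x = 0 \<or> x = 1 \<or> x = 2 \<or> x = 3 \<or> x = 4" if "x < 5" for x :: nat
    using that by linarith
  show ?thesis
    using assms(4-) lt5[OF assms(1)] lt5[OF assms(2)] lt5[OF assms(3)]
    by (elim disjE) (simp_all add: pentagon_adjacent_def)
qed

definition pentagon_coloring :: "nat set \<Rightarrow> nat" where
  "pentagon_coloring e = of_bool (\<exists>u\<in>e. \<exists>v\<in>e. pentagon_adjacent (u mod 5) (v mod 5))"

lemma pentagon_coloring_edge:
  "pentagon_coloring {u, v} = of_bool (pentagon_adjacent (u mod 5) (v mod 5))"
proof -
  have "x mod 5 \<noteq> (x mod 5 + 1) mod 5" for x :: nat by presburger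
  then show ?thesis by (auto simp: pentagon_coloring_def pentagon_adjacent_def)
qed

lemma pentagon_coloring_no_mono_triangle:
  assumes "p mod 5 \<noteq> q mod 5" "q mod 5 \<noteq> r mod 5" "p mod 5 \<noteq> r mod 5"
  shows "\<not> (pentagon_coloring {p, q} = pentagon_coloring {q, r} \<and>
            pentagon_coloring {q, r} = pentagon_coloring {p, r})"
  using pentagon_and_complement_triangle_free[OF _ _ _ assms]
  by (auto simp: pentagon_coloring_edge)

lemma pentagon_at_most_two: "at_most_colors 2 G pentagon_coloring"
proof -
  have "pentagon_coloring ` snd G \<subseteq> {0, 1}" by (auto simp: pentagon_coloring_def)
  then have "card (pentagon_coloring ` snd G) \<le> card {0::nat, 1}" by (intro card_mono) auto
  then show ?thesis by (simp add: at_most_colors_def)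
qed

text \<open>
  At most two colors in total means at most two colors at each vertex, so the local bound on cliques
  applies; for fewer than six vertices the residues modulo 5 are distinct and the pentagon coloring
  has no monochromatic triangle.
\<close>
lemma ramsey_number_K3_2: "ramsey_number (complete_graph 3) 2 = 6"
  unfolding ramsey_number_def
proof (rule Least_equality)
  show "\<forall>c. at_most_colors 2 (complete_graph 6) c \<longrightarrow>
      has_mono_copy (complete_graph 3) (complete_graph 6) c"
  proof (intro allI impI, rule ccontr)
    fix c assume c: "at_most_colors 2 (complete_graph 6) c"
      and "\<not> has_mono_copy (complete_graph 3) (complete_graph 6) c"
    then have "no_mono_triangle c {..<6}"
      by (intro no_mono_triangle_if_clique[of "complete_graph 6"]) (auto simp: complete_graph_def)
    moreover have "card (palette c {..<6} p) \<le> 2" if "p \<in> {..<6}" for p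
    proof -
      have "palette c {..<6} p \<subseteq> c ` [{..<6}]\<^bsup>2\<^esup>" using that by (auto simp: palette_def)
      then have "card (palette c {..<6} p) \<le> card (c ` [{..<6}]\<^bsup>2\<^esup>)"
        by (intro card_mono finite_imageI finite_imp_finite_nsets) auto
      then show ?thesis using c by (simp add: at_most_colors_def complete_graph_def)
    qed
    ultimately have "card {..<6::nat} \<le> 5" by (intro card_le_5_if_two_colored) auto
    then show False by simp
  qed
next
  fix N assume N: "\<forall>c. at_most_colors 2 (complete_graph N) c \<longrightarrow>
      has_mono_copy (complete_graph 3) (complete_graph N) c"
  show "6 \<le> N"
  proof (rule ccontr)
    assume "\<not> 6 \<le> N"
    have "has_mono_copy (complete_graph 3) (complete_graph N) pentagon_coloring"
      using N pentagon_at_most_two by blast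
    then obtain p q r where "p < N" "q < N" "r < N" "p \<noteq> q" "q \<noteq> r" "p \<noteq> r"
      "pentagon_coloring {p, q} = pentagon_coloring {q, r}"
      "pentagon_coloring {q, r} = pentagon_coloring {p, r}"
      unfolding has_mono_copy_K3_iff by (auto simp: complete_graph_def)
    then show False using pentagon_coloring_no_mono_triangle[of p q r] \<open>\<not> 6 \<le> N\<close> by auto
  qed
qed

lemma turan5_no_mono: "\<not> has_mono_copy (complete_graph 3) (turan5 n) pentagon_coloring"
proof -
  have "{u, v} \<in> snd (turan5 n) \<Longrightarrow> u mod 5 \<noteq> v mod 5" for u v
    by (auto simp: turan5_def doubleton_eq_iff)
  then show ?thesis
    using pentagon_coloring_no_mono_triangle unfolding has_mono_copy_K3_iff by blast
qed

section \<open>The extremal numbers\<close>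

lemma mean_coloring_if_at_most_colors:
  assumes G: "simple_graph G" and c: "at_most_colors k G c"
  shows "mean_coloring (real k) G c"
proof -
  have "card (incident_colors G c v) \<le> k" for v
  proof -
    have "card (incident_colors G c v) \<le> card (c ` snd G)"
      using finite_edges[OF G] by (intro card_mono) (auto simp: incident_colors_def)
    then show ?thesis using c by (simp add: at_most_colors_def)
  qed
  then have "(\<Sum>v\<in>fst G. real (card (incident_colors G c v))) \<le> real (card (fst G)) * real k"
    by (intro sum_bounded_above) simp
  then show ?thesis by (cases "card (fst G) = 0") (auto simp: mean_coloring_def field_simps)
qed

theorem theorem1p3:
  fixes n :: nat
  assumes "n > 0"
  shows "RT_mean n (complete_graph 3) 2 = RT_colors n (complete_graph 3) 2 \<and>
         RT_colors n (complete_graph 3) 2 = turan_number n (ramsey_number (complete_graph 3) 2 - 1) \<and>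
         turan_number n (ramsey_number (complete_graph 3) 2 - 1) = turan_number n 5 \<and>
         int (turan_number n 5) = \<lfloor>0.4 * real n ^ 2\<rfloor>"
proof -
  have upper: "card (snd G) \<le> turan_number n 5"
    if "simple_graph G" "card (fst G) = n" "mean_coloring 2 G c"
      "\<not> has_mono_copy (complete_graph 3) G c" for G :: "nat ugraph" and c
  proof -
    have "fst G \<noteq> {}" using that(2) assms by auto
    then have "real (card (snd G)) \<le> 0.4 * (real n)\<^sup>2"
      using two_mean_edge_bound[OF that(1) _ that(3,4)] that(2) by simp
    then have "int (card (snd G)) \<le> int (turan_number n 5)"
      unfolding turan_number_5 by (simp add: le_floor_iff)
    then show ?thesis by simp
  qed
  have turan5: "simple_graph (turan5 n)" "card (fst (turan5 n)) = n"
      "card (snd (turan5 n)) = turan_number n 5"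
    using simple_graph_turan5 card_edges_turan5 by (auto simp: turan5_def)
  have mean: "mean_coloring 2 G c" if "simple_graph G" "at_most_colors 2 G c" for G :: "nat ugraph" and c
    using mean_coloring_if_at_most_colors[OF that] by simp
  define A where "A = {card (snd G) | G :: nat ugraph. simple_graph G \<and> card (fst G) = n \<and>
            (\<exists>c. mean_coloring 2 G c \<and> \<not> has_mono_copy (complete_graph 3) G c)}"
  define C where "C = {card (snd G) | G :: nat ugraph. simple_graph G \<and> card (fst G) = n \<and>
            (\<exists>c. at_most_colors 2 G c \<and> \<not> has_mono_copy (complete_graph 3) G c)}"
  have "C \<subseteq> A" unfolding A_def C_def using mean by blast
  have A: "x \<le> turan_number n 5" if "x \<in> A" for x
    using that upper unfolding A_def by blast
  then have "A \<subseteq> {..turan_number n 5}" by auto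
  then have fin: "finite A" by (rule finite_subset) simp
  have "turan_number n 5 \<in> C"
    unfolding C_def using turan5 pentagon_at_most_two turan5_no_mono
    by (intro CollectI exI[of _ "turan5 n"] conjI exI[of _ pentagon_coloring]) auto
  then have "Max A = turan_number n 5" "Max C = turan_number n 5"
    using A \<open>C \<subseteq> A\<close> fin finite_subset[OF \<open>C \<subseteq> A\<close> fin] by (auto intro!: Max_eqI)
  then have "RT_mean n (complete_graph 3) 2 = turan_number n 5"
      "RT_colors n (complete_graph 3) 2 = turan_number n 5"
    unfolding RT_mean_def RT_colors_def A_def C_def .
  then show ?thesis by (simp add: ramsey_number_K3_2 turan_number_5)
qed

end
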